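(* For every uncountable regular cardinal $\tau\le \mathfrak{c}^+$ there exists a precompact abelian group $G$ with uncountable pseudocharacter such that $\operatorname{pfi}(G)=\tau$.
   Context: All topological groups are Hausdorff. $\mathfrak{c}=2^\omega$ is the cardinality of the continuum and $\mathfrak{c}^+$ is its cardinal successor. A topological group is precompact if its Weil completion is a compact group. The pseudocharacter $\psi(G)$ of a topological group $G$ is the least cardinal $\kappa$ such that there is a family of $\kappa$ open neighbourhoods of the identity $1_G$ whose intersection is $\{1_G\}$. For an infinite cardinal $\tau$, a topological group $G$ is pseudo-$\tau$-fine if for every family $\{U_\alpha:\alpha\in\tau\}$ of identity neighbourhoods there is a countable family $\{V_n:n\in\omega\}$ of identity neighbourhoods with $\bigcap_{n\in\omega}V_n\subseteq\bigcap_{\alpha\in\tau}U_\alpha$. For a topological group $G$ with uncountable pseudocharacter, the pseudo-fineness index $\operatorname{pfi}(G)$ is the least (infinite) cardinal $\tau$ such that $G$ is not pseudo-$\tau$-fine. *)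

theory Defs
  imports "HOL-Analysis.Analysis" "HOL-Algebra.Group"
begin

unbundle cardinal_syntax

locale topological_group = group G for G :: "'g monoid" (structure) +
  fixes T :: "'g topology"
  assumes topspace_eq_carrier: "topspace T = carrier G"
    and continuous_mult: "continuous_map (prod_topology T T) T (\<lambda>(x, y). x \<otimes> y)"
    and continuous_inv: "continuous_map T T (\<lambda>x. inv x)"
    and Hausdorff: "Hausdorff_space T"

definition identity_nhd :: "'g monoid \<Rightarrow> 'g topology \<Rightarrow> 'g set \<Rightarrow> bool" where
  "identity_nhd G T U \<longleftrightarrow>
     U \<subseteq> carrier G \<and> (\<exists>W. openin T W \<and> \<one>\<^bsub>G\<^esub> \<in> W \<and> W \<subseteq> U)"

text \<open>Cauchy filters and completeness refer to the left uniformity, whose entourages are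
  the sets of pairs \<open>(x, y)\<close> with \<open>x\<^sup>-\<^sup>1 y \<in> U\<close>, for \<open>U\<close> an identity neighbourhood.\<close>

definition left_cauchy_filter :: "'g monoid \<Rightarrow> 'g topology \<Rightarrow> 'g filter \<Rightarrow> bool" where
  "left_cauchy_filter G T F \<longleftrightarrow>
     F \<noteq> bot \<and> eventually (\<lambda>x. x \<in> carrier G) F \<and>
     (\<forall>U. identity_nhd G T U \<longrightarrow>
        (\<exists>A \<subseteq> carrier G. eventually (\<lambda>x. x \<in> A) F \<and>
           (\<forall>x\<in>A. \<forall>y\<in>A. inv\<^bsub>G\<^esub> x \<otimes>\<^bsub>G\<^esub> y \<in> U)))"

definition weil_complete :: "'g monoid \<Rightarrow> 'g topology \<Rightarrow> bool" where
  "weil_complete G T \<longleftrightarrow>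
     (\<forall>F. left_cauchy_filter G T F \<longrightarrow> (\<exists>l. limitin T (\<lambda>x. x) l F))"

text \<open>The Weil completion is determined, up to a unique isomorphism over \<open>G\<close>, as a complete
  Hausdorff group in which \<open>G\<close> is embedded as a dense topological subgroup.\<close>

definition is_weil_completion ::
    "'g monoid \<Rightarrow> 'g topology \<Rightarrow> 'h monoid \<Rightarrow> 'h topology \<Rightarrow> ('g \<Rightarrow> 'h) \<Rightarrow> bool" where
  "is_weil_completion G T K S e \<longleftrightarrow>
     topological_group K S \<and> weil_complete K S \<and>
     e \<in> hom G K \<and> embedding_map T S e \<and> S closure_of (e ` carrier G) = carrier K"

text \<open>The type \<open>'g set set\<close> is no restriction on the completion: every point of the completion
  is the limit of the image of a filter on \<open>G\<close> (the trace of its neighbourhood filter), so the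
  completion has a copy whose points are families of subsets of \<open>G\<close>.\<close>

definition precompact_group :: "'g monoid \<Rightarrow> 'g topology \<Rightarrow> bool" where
  "precompact_group G T \<longleftrightarrow>
     topological_group G T \<and>
     (\<exists>(K :: 'g set set monoid) S e. is_weil_completion G T K S e \<and> compact_space S)"

text \<open>Cardinals are represented, as in the library, by relations \<open>\<kappa>\<close> with \<open>Card_order \<kappa>\<close>, and
  identified along \<open>=o\<close>; a family indexed by \<open>\<kappa>\<close> is a family indexed by \<open>Field \<kappa>\<close>.\<close>

definition least_cardinal :: "('k rel \<Rightarrow> bool) \<Rightarrow> 'k rel" where
  "least_cardinal P =
     (SOME \<kappa>. Card_order \<kappa> \<and> P \<kappa> \<and> (\<forall>\<kappa>'. Card_order \<kappa>' \<and> P \<kappa>' \<longrightarrow> \<kappa> \<le>o \<kappa>'))"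

lemma least_cardinal:
  assumes "Card_order \<kappa>" "P \<kappa>"
  shows "Card_order (least_cardinal P)" "P (least_cardinal P)"
    and "\<And>\<kappa>'. Card_order \<kappa>' \<Longrightarrow> P \<kappa>' \<Longrightarrow> least_cardinal P \<le>o \<kappa>'"
proof -
  have "\<exists>r\<in>{\<kappa>. Card_order \<kappa> \<and> P \<kappa>}. \<forall>r'\<in>{\<kappa>. Card_order \<kappa> \<and> P \<kappa>}. r \<le>o r'"
    by (rule exists_minim_Card_order) (use assms in auto)
  then have "\<exists>r. Card_order r \<and> P r \<and> (\<forall>r'. Card_order r' \<and> P r' \<longrightarrow> r \<le>o r')"
    by blast
  from someI_ex[OF this]
  show "Card_order (least_cardinal P)" "P (least_cardinal P)"
    and "\<And>\<kappa>'. Card_order \<kappa>' \<Longrightarrow> P \<kappa>' \<Longrightarrow> least_cardinal P \<le>o \<kappa>'"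
    unfolding least_cardinal_def by blast+
qed

text \<open>In both invariants below, cardinals on the type \<open>'g set\<close> suffice, since only families of
  subsets of \<open>G\<close> matter.\<close>

definition pseudocharacter :: "'g monoid \<Rightarrow> 'g topology \<Rightarrow> 'g set rel" where
  "pseudocharacter G T = least_cardinal (\<lambda>\<kappa>. \<exists>U :: 'g set \<Rightarrow> 'g set.
     (\<forall>a\<in>Field \<kappa>. openin T (U a) \<and> \<one>\<^bsub>G\<^esub> \<in> U a) \<and>
     carrier G \<inter> (\<Inter>a\<in>Field \<kappa>. U a) = {\<one>\<^bsub>G\<^esub>})"

definition pseudo_fine :: "'g monoid \<Rightarrow> 'g topology \<Rightarrow> 'k rel \<Rightarrow> bool" where
  "pseudo_fine G T \<tau> \<longleftrightarrow>
     (\<forall>U. (\<forall>a\<in>Field \<tau>. identity_nhd G T (U a)) \<longrightarrow>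
        (\<exists>V :: nat \<Rightarrow> 'g set. (\<forall>n. identity_nhd G T (V n)) \<and>
           (\<Inter>n. V n) \<subseteq> (\<Inter>a\<in>Field \<tau>. U a)))"

text \<open>Meaningful only for groups of uncountable pseudocharacter: otherwise no cardinal satisfies
  the condition and the value is unspecified.\<close>

definition pfi :: "'g monoid \<Rightarrow> 'g topology \<Rightarrow> 'g set rel" where
  "pfi G T = least_cardinal (\<lambda>\<tau>. infinite (Field \<tau>) \<and> \<not> pseudo_fine G T \<tau>)"

abbreviation continuum :: "(nat \<Rightarrow> bool) rel" where
  "continuum \<equiv> ctwo ^c natLeq"

end

theory Submission imports Defs begin

text \<open>Let \<open>G\<close> be the Boolean group of finite subsets of \<open>\<tau>\<close> with the topology generated by the
  characters \<open>X \<mapsto> |X \<inter> B| mod 2\<close>, where \<open>B\<close> ranges over the bounded subsets of \<open>\<tau>\<close>. Every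
  identity neighbourhood contains a subgroup \<open>H\<^sub>a\<close> of all \<open>X\<close> disjoint from the initial segment
  below \<open>a\<close>, and by regularity so does every intersection of fewer than \<open>\<tau>\<close> neighbourhoods. As
  \<open>\<tau> \<le> \<cc>\<^sup>+\<close>, the initial segment embeds into the Cantor set, and the traces of basic clopen sets
  give countably many characters whose kernels intersect inside \<open>H\<^sub>a\<close>; hence \<open>G\<close> is
  pseudo-\<open>\<kappa>\<close>-fine for all \<open>\<kappa> < \<tau>\<close>. No \<open>H\<^sub>a\<close> is trivial, so no countable intersection of
  neighbourhoods is, although the \<open>\<tau>\<close> kernels of the characters with \<open>|B| = 1\<close> meet in the
  identity.\<close>

section \<open>Subgroups of compact groups\<close>

lemma topological_groupD:
  assumes "topological_group K S"
  shows "group K" "topspace S = carrier K"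
    "continuous_map (prod_topology S S) S (\<lambda>(x, y). x \<otimes>\<^bsub>K\<^esub> y)"
    "continuous_map S S (\<lambda>x. inv\<^bsub>K\<^esub> x)" "Hausdorff_space S"
  using assms by (auto simp: topological_group_def topological_group_axioms_def)

lemma topological_groupI:
  assumes "group K" "topspace S = carrier K"
    "continuous_map (prod_topology S S) S (\<lambda>(x, y). x \<otimes>\<^bsub>K\<^esub> y)"
    "continuous_map S S (\<lambda>x. inv\<^bsub>K\<^esub> x)" "Hausdorff_space S"
  shows "topological_group K S"
  using assms by (auto simp: topological_group_def topological_group_axioms_def)

text \<open>Closures commute with finite products, so continuity of multiplication sends
  \<open>closure(H) \<times> closure(H)\<close> into the closure of the products from
  \<open>H\<close>, which lie in \<open>H\<close>. Inversion is treated in the same way.\<close>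

lemma subgroup_closure_of:
  assumes K: "topological_group K S" and H: "subgroup H K"
  shows "subgroup (S closure_of H) K"
proof -
  interpret H: subgroup H K by fact
  note K = topological_groupD[OF K]
  let ?C = "S closure_of H"
  show ?thesis
  proof
    show "?C \<subseteq> carrier K"
      using closure_of_subset_topspace K(2) by metis
    show "\<one>\<^bsub>K\<^esub> \<in> ?C"
      using closure_of_subset[of H S] K(2) H.subset by auto
  next
    fix x y assume "x \<in> ?C" "y \<in> ?C"
    then have "(x, y) \<in> prod_topology S S closure_of (H \<times> H)"
      by (simp add: closure_of_Times)
    then have "x \<otimes>\<^bsub>K\<^esub> y \<in> S closure_of ((\<lambda>(x, y). x \<otimes>\<^bsub>K\<^esub> y) ` (H \<times> H))"
      using continuous_map_image_closure_subset[OF K(3)] by fastforce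
    moreover have "(\<lambda>(x, y). x \<otimes>\<^bsub>K\<^esub> y) ` (H \<times> H) \<subseteq> H" by auto
    ultimately show "x \<otimes>\<^bsub>K\<^esub> y \<in> ?C"
      using closure_of_mono by blast
  next
    fix x assume "x \<in> ?C"
    then have "inv\<^bsub>K\<^esub> x \<in> S closure_of ((\<lambda>x. inv\<^bsub>K\<^esub> x) ` H)"
      using continuous_map_image_closure_subset[OF K(4)] by fastforce
    moreover have "(\<lambda>x. inv\<^bsub>K\<^esub> x) ` H \<subseteq> H" by auto
    ultimately show "inv\<^bsub>K\<^esub> x \<in> ?C"
      using closure_of_mono by blast
  qed
qed

lemma topological_group_subgroup:
  assumes K: "topological_group K S" and C: "subgroup C K"
  shows "topological_group (K\<lparr>carrier := C\<rparr>) (subtopology S C)"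
proof -
  note KK = topological_groupD[OF K]
  interpret group K by fact
  interpret C: subgroup C K by fact
  have inv: "inv\<^bsub>K\<lparr>carrier := C\<rparr>\<^esub> x = inv\<^bsub>K\<^esub> x" if "x \<in> C" for x
    using m_inv_consistent[OF C that] .
  have top: "topspace (subtopology S C) = C"
    using KK(2) C.subset by auto
  show ?thesis
  proof (rule topological_groupI)
    show "group (K\<lparr>carrier := C\<rparr>)" by (rule subgroup_imp_group) fact
    show "topspace (subtopology S C) = carrier (K\<lparr>carrier := C\<rparr>)"
      using top by simp
    show "Hausdorff_space (subtopology S C)"
      by (simp add: Hausdorff_space_subtopology KK(5))
    have "continuous_map (prod_topology (subtopology S C) (subtopology S C)) S
       (\<lambda>(x, y). x \<otimes>\<^bsub>K\<^esub> y)"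
      unfolding subtopology_Times[symmetric]
      by (rule continuous_map_from_subtopology) (rule KK(3))
    then show "continuous_map (prod_topology (subtopology S C) (subtopology S C)) (subtopology S C)
       (\<lambda>(x, y). x \<otimes>\<^bsub>K\<lparr>carrier := C\<rparr>\<^esub> y)"
      by (auto simp: continuous_map_in_subtopology)
    have "continuous_map (subtopology S C) S (\<lambda>x. inv\<^bsub>K\<lparr>carrier := C\<rparr>\<^esub> x)"
      by (rule continuous_map_eq[OF continuous_map_from_subtopology[OF KK(4)]]) (use top inv in auto)
    then show "continuous_map (subtopology S C) (subtopology S C) (\<lambda>x. inv\<^bsub>K\<lparr>carrier := C\<rparr>\<^esub> x)"
      by (auto simp: continuous_map_in_subtopology inv)
  qed
qed

text \<open>A map into a pullback topology is continuous as soon as its composite with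
  \<open>e\<close> is. The homomorphism law rewrites these composites as operations of
  \<open>K\<close>, and injectivity of \<open>e\<close> transfers the Hausdorff property.\<close>

lemma topological_group_pullback:
  assumes G: "group G" and K: "topological_group K S"
    and e: "e \<in> hom G K" "inj_on e (carrier G)"
  shows "topological_group G (pullback_topology (carrier G) e S)" (is "topological_group G ?T")
proof -
  note KK = topological_groupD[OF K]
  interpret group_hom G K e
    using G KK(1) e(1) by (simp add: group_hom_def group_hom_axioms_def)
  have top: "topspace ?T = carrier G"
    using KK(2) by (auto simp: topspace_pullback_topology)
  have e_cont: "continuous_map ?T S e"
    using continuous_map_pullback[OF continuous_map_id, of "carrier G" e S] by simp
  show ?thesis
  proof (rule topological_groupI)
    have *: "continuous_map (prod_topology ?T ?T) (prod_topology S S) (\<lambda>(x, y). (e x, e y))"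
      by (simp add: continuous_map_prod_top e_cont)
    have "continuous_map (prod_topology ?T ?T) S (e \<circ> (\<lambda>(x, y). x \<otimes>\<^bsub>G\<^esub> y))"
      by (rule continuous_map_eq[OF continuous_map_compose[OF * KK(3)]]) (auto simp: top)
    then show "continuous_map (prod_topology ?T ?T) ?T (\<lambda>(x, y). x \<otimes>\<^bsub>G\<^esub> y)"
      by (rule continuous_map_pullback') (auto simp: top)
    have "continuous_map ?T S (e \<circ> (\<lambda>x. inv\<^bsub>G\<^esub> x))"
      by (rule continuous_map_eq[OF continuous_map_compose[OF e_cont KK(4)]]) (auto simp: top)
    then show "continuous_map ?T ?T (\<lambda>x. inv\<^bsub>G\<^esub> x)"
      by (rule continuous_map_pullback') (auto simp: top)
    show "Hausdorff_space ?T"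
      using Hausdorff_space_injective_preimage[OF KK(5) e_cont] e(2) top by simp
  qed (use G top in auto)
qed

text \<open>Compactness gives every proper filter a cluster point, and a Cauchy filter converges to
  each of its cluster points.\<close>

lemma compact_imp_weil_complete:
  assumes K: "topological_group K S" and "compact_space S"
  shows "weil_complete K S"
  unfolding weil_complete_def
proof (intro allI impI)
  fix F assume F: "left_cauchy_filter K S F"
  note KK = topological_groupD[OF K]
  interpret group K by fact
  have nbot: "F \<noteq> bot" and carr: "eventually (\<lambda>x. x \<in> carrier K) F"
    using F by (auto simp: left_cauchy_filter_def)
  \<comment> \<open>This is the cluster point. If every point had a neighbourhood avoided eventually
    by \<open>F\<close>, finitely many such neighbourhoods would cover the space, and
    \<open>F\<close> would contain the empty set.\<close>
  have "\<exists>l\<in>carrier K. \<forall>W. openin S W \<and> l \<in> W \<longrightarrow> \<not> eventually (\<lambda>x. x \<notin> W) F"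
  proof (rule ccontr)
    assume "\<not> ?thesis"
    then have "\<forall>l\<in>carrier K. \<exists>W. openin S W \<and> l \<in> W \<and> eventually (\<lambda>x. x \<notin> W) F"
      by blast
    then obtain W where W: "\<And>l. l \<in> carrier K \<Longrightarrow>
        openin S (W l) \<and> l \<in> W l \<and> eventually (\<lambda>x. x \<notin> W l) F"
      by metis
    have "\<exists>\<F>. finite \<F> \<and> \<F> \<subseteq> W ` carrier K \<and> topspace S \<subseteq> \<Union>\<F>"
    proof -
      have "Ball (W ` carrier K) (openin S)" "topspace S \<subseteq> \<Union>(W ` carrier K)"
        using W by (auto simp: KK(2))
      then show ?thesis using \<open>compact_space S\<close> unfolding compact_space_alt by blast
    qed
    then obtain A where A: "finite A" "A \<subseteq> carrier K" "topspace S \<subseteq> \<Union>(W ` A)"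
      by (metis finite_subset_image)
    have "eventually (\<lambda>x. \<forall>l\<in>A. x \<notin> W l) F"
      using A W by (auto simp: eventually_ball_finite_distrib)
    with carr have "eventually (\<lambda>x. False) F"
      by eventually_elim (use A KK(2) in auto)
    with nbot show False by (simp add: eventually_False)
  qed
  then obtain l where l: "l \<in> carrier K"
    and lW: "\<And>W. openin S W \<Longrightarrow> l \<in> W \<Longrightarrow> \<not> eventually (\<lambda>x. x \<notin> W) F"
    by blast
  have "limitin S (\<lambda>x. x) l F"
    unfolding limitin_def
  proof (intro conjI allI impI)
    show "l \<in> topspace S" using l KK(2) by simp
    fix W assume W: "openin S W \<and> l \<in> W"
    \<comment> \<open>Continuity of multiplication at the pair of \<open>l\<close> and the identity
      yields open \<open>V\<close> and \<open>U\<close> with products in \<open>W\<close>. A set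
      \<open>A\<close> of the filter that is small of order \<open>U\<close> meets \<open>V\<close>
      in some \<open>x\<close>, so each \<open>y\<close> in \<open>A\<close> is the product of
      \<open>x\<close> in \<open>V\<close> and \<open>inv x \<otimes> y\<close> in
      \<open>U\<close>.\<close>
    define P where "P = {p \<in> topspace (prod_topology S S). (\<lambda>(x, y). x \<otimes>\<^bsub>K\<^esub> y) p \<in> W}"
    have "openin (prod_topology S S) P"
      unfolding P_def using openin_continuous_map_preimage[OF KK(3)] W by blast
    moreover have "(l, \<one>\<^bsub>K\<^esub>) \<in> P" using l W KK(2) by (simp add: P_def)
    ultimately obtain V U where VU: "openin S V" "openin S U" "l \<in> V" "\<one>\<^bsub>K\<^esub> \<in> U" "V \<times> U \<subseteq> P"
      unfolding openin_prod_topology_alt by meson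
    have "identity_nhd K S U"
      unfolding identity_nhd_def using VU openin_subset KK(2) by blast
    then have "\<exists>A \<subseteq> carrier K. eventually (\<lambda>x. x \<in> A) F \<and> (\<forall>x\<in>A. \<forall>y\<in>A. inv\<^bsub>K\<^esub> x \<otimes>\<^bsub>K\<^esub> y \<in> U)"
      using F by (simp add: left_cauchy_filter_def)
    then obtain A where A: "A \<subseteq> carrier K" "eventually (\<lambda>x. x \<in> A) F"
      "\<And>x y. x \<in> A \<Longrightarrow> y \<in> A \<Longrightarrow> inv\<^bsub>K\<^esub> x \<otimes>\<^bsub>K\<^esub> y \<in> U"
      by blast
    have "\<not> eventually (\<lambda>x. \<not> (x \<in> V \<and> x \<in> A)) F"
    proof
      assume "eventually (\<lambda>x. \<not> (x \<in> V \<and> x \<in> A)) F"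
      with A(2) have "eventually (\<lambda>x. x \<notin> V) F" by eventually_elim auto
      with lW VU show False by blast
    qed
    then obtain x where x: "x \<in> V" "x \<in> A"
      by (blast dest: not_eventuallyD)
    show "eventually (\<lambda>y. y \<in> W) F"
      using A(2)
    proof eventually_elim
      fix y assume y: "y \<in> A"
      have "(x, inv\<^bsub>K\<^esub> x \<otimes>\<^bsub>K\<^esub> y) \<in> P" using VU(5) x y A(3) by blast
      then have "x \<otimes>\<^bsub>K\<^esub> (inv\<^bsub>K\<^esub> x \<otimes>\<^bsub>K\<^esub> y) \<in> W" by (simp add: P_def)
      moreover have "x \<otimes>\<^bsub>K\<^esub> (inv\<^bsub>K\<^esub> x \<otimes>\<^bsub>K\<^esub> y) = y"
        using x y A(1) by (simp add: subset_iff flip: m_assoc)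
      ultimately show "y \<in> W" by simp
    qed
  qed
  then show "\<exists>l. limitin S (\<lambda>x. x) l F" ..
qed

text \<open>The completion is the closure of the image of \<open>e\<close>: it is compact as a
  closed subset of a compact space, hence complete. As open sets of the pullback are preimages,
  \<open>e\<close> is a homeomorphism onto its image.\<close>

lemma precompact_group_pullback:
  fixes G :: "'g monoid" and K :: "'g set set monoid"
  assumes G: "group G" and K: "topological_group K S" and comp: "compact_space S"
    and e: "e \<in> hom G K" "inj_on e (carrier G)"
  shows "precompact_group G (pullback_topology (carrier G) e S)" (is "precompact_group G ?T")
proof -
  note KK = topological_groupD[OF K]
  interpret group_hom G K e
    using G KK(1) e(1) by (simp add: group_hom_def group_hom_axioms_def)
  define C where "C = S closure_of (e ` carrier G)"
  have sub: "subgroup C K"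
    unfolding C_def by (intro subgroup_closure_of K img_is_subgroup)
  have eC: "e ` carrier G \<subseteq> C"
    unfolding C_def by (rule closure_of_subset) (simp add: KK(2) image_subset_iff)
  have grp: "topological_group (K\<lparr>carrier := C\<rparr>) (subtopology S C)"
    by (rule topological_group_subgroup[OF K sub])
  have compC: "compact_space (subtopology S C)"
    unfolding C_def by (intro compact_space_subtopology closedin_compact_space comp closedin_closure_of)
  note T = topological_group_pullback[OF G K e]
  note top = topological_groupD(2)[OF T]
  have "homeomorphic_map ?T (subtopology S (e ` carrier G)) e"
  proof (rule bijective_open_imp_homeomorphic_map)
    have "continuous_map ?T S e"
      using continuous_map_pullback[OF continuous_map_id, of "carrier G" e S] by simp
    then show "continuous_map ?T (subtopology S (e ` carrier G)) e"
      by (auto simp: continuous_map_in_subtopology top)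
    show "open_map ?T (subtopology S (e ` carrier G)) e"
      unfolding open_map_def openin_pullback_topology openin_subtopology by blast
    show "e ` topspace ?T = topspace (subtopology S (e ` carrier G))"
      using top KK(2) by auto
    show "inj_on e (topspace ?T)" using top e(2) by simp
  qed
  then have emb: "embedding_map ?T (subtopology S C) e"
    unfolding embedding_map_def top subtopology_subtopology
    using eC by (simp add: inf_absorb2)
  have "is_weil_completion G ?T (K\<lparr>carrier := C\<rparr>) (subtopology S C) e"
    unfolding is_weil_completion_def
  proof (intro conjI grp emb compact_imp_weil_complete compC)
    show "e \<in> hom G (K\<lparr>carrier := C\<rparr>)"
      using eC by (auto simp: hom_def)
    show "subtopology S C closure_of e ` carrier G = carrier (K\<lparr>carrier := C\<rparr>)"
      using eC by (simp add: closure_of_subtopology inf_absorb2 C_def)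
  qed
  with compC T show ?thesis
    unfolding precompact_group_def by blast
qed

section \<open>Powersets as compact Boolean groups\<close>

definition symdiff_group :: "'b set set \<Rightarrow> 'b set monoid" where
  "symdiff_group \<A> = \<lparr>carrier = \<A>, mult = sym_diff, one = {}\<rparr>"

lemma symdiff_group_simps [simp]:
  "carrier (symdiff_group \<A>) = \<A>" "A \<otimes>\<^bsub>symdiff_group \<A>\<^esub> B = sym_diff A B"
  "\<one>\<^bsub>symdiff_group \<A>\<^esub> = {}"
  by (auto simp: symdiff_group_def)

lemma comm_group_symdiff_group:
  assumes "{} \<in> \<A>" "\<And>A B. A \<in> \<A> \<Longrightarrow> B \<in> \<A> \<Longrightarrow> sym_diff A B \<in> \<A>"
  shows "comm_group (symdiff_group \<A>)"
proof (rule comm_groupI)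
  fix A assume "A \<in> carrier (symdiff_group \<A>)"
  then show "\<exists>B\<in>carrier (symdiff_group \<A>). B \<otimes>\<^bsub>symdiff_group \<A>\<^esub> A = \<one>\<^bsub>symdiff_group \<A>\<^esub>"
    by (intro bexI[of _ A]) auto
qed (use assms in auto)

lemma inv_symdiff_group:
  assumes "group (symdiff_group \<A>)" "A \<in> \<A>"
  shows "inv\<^bsub>symdiff_group \<A>\<^esub> A = A"
  using group.inv_equality[OF assms(1), of A A] assms(2) by simp

text \<open>The Cantor cube over \<open>J\<close>, with subsets of \<open>J\<close> as points in
  place of their indicator functions.\<close>

definition powerset_topology :: "'b set \<Rightarrow> 'b set topology" where
  "powerset_topology J = pullback_topology (Pow J) (\<lambda>A. \<lambda>i\<in>J. i \<in> A)
     (product_topology (\<lambda>_. discrete_topology UNIV) J)"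

lemma topspace_powerset_topology [simp]: "topspace (powerset_topology J) = Pow J"
  by (auto simp: powerset_topology_def topspace_pullback_topology)

lemma continuous_map_into_powerset_topology:
  assumes "\<And>x. x \<in> topspace X \<Longrightarrow> f x \<subseteq> J"
    and "\<And>i. i \<in> J \<Longrightarrow> continuous_map X (discrete_topology UNIV) (\<lambda>x. i \<in> f x)"
  shows "continuous_map X (powerset_topology J) f"
  unfolding powerset_topology_def
  by (rule continuous_map_pullback') (use assms in \<open>auto simp: continuous_map_componentwise o_def\<close>)

lemma continuous_map_member_powerset_topology:
  assumes "i \<in> J"
  shows "continuous_map (powerset_topology J) (discrete_topology UNIV) (\<lambda>A. i \<in> A)"
proof -
  have "continuous_map (powerset_topology J) (discrete_topology UNIV) ((\<lambda>f. f i) \<circ> (\<lambda>A. \<lambda>i\<in>J. i \<in> A))"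
    unfolding powerset_topology_def
    by (rule continuous_map_pullback) (use assms in \<open>auto intro: continuous_map_product_projection\<close>)
  then show ?thesis using assms by (simp add: o_def)
qed

text \<open>The powerset is a continuous image of the cube, which is compact by Tychonoff.\<close>

lemma compact_space_powerset_topology: "compact_space (powerset_topology J)"
proof -
  let ?P = "product_topology (\<lambda>_. discrete_topology (UNIV :: bool set)) J"
  have "compact_space ?P"
    by (simp add: compact_space_product_topology compact_space_discrete_topology)
  moreover have "continuous_map ?P (powerset_topology J) (\<lambda>f. {i \<in> J. f i})"
    by (rule continuous_map_into_powerset_topology)
      (auto intro: continuous_map_product_projection)
  ultimately have "compactin (powerset_topology J) ((\<lambda>f. {i \<in> J. f i}) ` topspace ?P)"
    unfolding compact_space_def by (rule image_compactin)
  moreover have "(\<lambda>f. {i \<in> J. f i}) ` topspace ?P = Pow J"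
  proof (intro equalityI subsetI)
    fix A assume "A \<in> Pow J"
    then show "A \<in> (\<lambda>f. {i \<in> J. f i}) ` topspace ?P"
      by (intro image_eqI[of _ _ "\<lambda>i\<in>J. i \<in> A"]) auto
  qed auto
  ultimately show ?thesis by (simp add: compact_space_def)
qed

lemma Hausdorff_space_powerset_topology: "Hausdorff_space (powerset_topology J)"
proof -
  let ?P = "product_topology (\<lambda>_. discrete_topology (UNIV :: bool set)) J"
  have "continuous_map (powerset_topology J) ?P (\<lambda>A. \<lambda>i\<in>J. i \<in> A)"
    using continuous_map_pullback[OF continuous_map_id, of "Pow J" "\<lambda>A. \<lambda>i\<in>J. i \<in> A" ?P]
    by (simp add: powerset_topology_def)
  moreover have "inj_on (\<lambda>A. \<lambda>i\<in>J. i \<in> A) (topspace (powerset_topology J))"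
  proof (rule inj_onI)
    fix A B assume AB: "A \<in> topspace (powerset_topology J)" "B \<in> topspace (powerset_topology J)"
      and eq: "(\<lambda>i\<in>J. i \<in> A) = (\<lambda>i\<in>J. i \<in> B)"
    have "i \<in> A \<longleftrightarrow> i \<in> B" if "i \<in> J" for i
      using fun_cong[OF eq, of i] that by simp
    with AB show "A = B" by auto
  qed
  moreover have "Hausdorff_space ?P"
    by (simp add: Hausdorff_space_product_topology)
  ultimately show ?thesis
    using Hausdorff_space_injective_preimage by blast
qed

text \<open>Continuity is checked coordinatewise: membership in a symmetric difference is the
  exclusive or of two memberships. Inversion is the identity map, since every element is its own
  inverse.\<close>

lemma topological_group_Pow:
  "topological_group (symdiff_group (Pow J)) (powerset_topology J)"
proof (rule topological_groupI)
  show grp: "group (symdiff_group (Pow J))"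
    by (rule comm_group.axioms(2), rule comm_group_symdiff_group) auto
  let ?X = "powerset_topology J"
  have "continuous_map (prod_topology ?X ?X) (discrete_topology UNIV) (\<lambda>p. i \<in> sym_diff (fst p) (snd p))"
    if i: "i \<in> J" for i
  proof -
    \<comment> \<open>The pair of bits lives in a discrete space, from which every function, in
      particular the exclusive or, is continuous.\<close>
    have "continuous_map (prod_topology ?X ?X) (discrete_topology (UNIV \<times> UNIV))
        (\<lambda>p. (i \<in> fst p, i \<in> snd p))"
      unfolding prod_topology_discrete_topology
      using continuous_map_compose[OF continuous_map_fst continuous_map_member_powerset_topology[OF i]]
        continuous_map_compose[OF continuous_map_snd continuous_map_member_powerset_topology[OF i]]
      by (auto intro!: continuous_map_pairedI simp: o_def)
    then have "continuous_map (prod_topology ?X ?X) (discrete_topology UNIV)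
       ((\<lambda>(a, b). a \<noteq> b) \<circ> (\<lambda>p. (i \<in> fst p, i \<in> snd p)))"
      by (rule continuous_map_compose) simp
    then show ?thesis
      by (rule continuous_map_eq) auto
  qed
  then show "continuous_map (prod_topology ?X ?X) ?X (\<lambda>(A, B). A \<otimes>\<^bsub>symdiff_group (Pow J)\<^esub> B)"
    unfolding case_prod_beta
    by (intro continuous_map_into_powerset_topology) auto
  show "continuous_map ?X ?X (\<lambda>A. inv\<^bsub>symdiff_group (Pow J)\<^esub> A)"
    by (rule continuous_map_eq[OF continuous_map_id]) (use inv_symdiff_group[OF grp] in auto)
qed (simp_all add: Hausdorff_space_powerset_topology)

text \<open>A basic open set restricts only finitely many coordinates, and these form
  \<open>F\<close>. A set avoiding \<open>F\<close> agrees with the empty set on all of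
  them.\<close>

lemma powerset_topology_nhd_empty:
  assumes "openin (powerset_topology J) W" "{} \<in> W"
  obtains F where "finite F" "F \<subseteq> J" "\<And>A. A \<subseteq> J \<Longrightarrow> A \<inter> F = {} \<Longrightarrow> A \<in> W"
proof -
  let ?h = "\<lambda>A. \<lambda>i\<in>J. i \<in> A"
  obtain U where U: "openin (product_topology (\<lambda>_. discrete_topology (UNIV :: bool set)) J) U"
    and W: "W = ?h -` U \<inter> Pow J"
    using assms(1) unfolding powerset_topology_def openin_pullback_topology by blast
  have "?h {} \<in> U" using assms(2) W by auto
  then obtain V where V: "finite {i \<in> J. V i \<noteq> UNIV}" "?h {} \<in> Pi\<^sub>E J V" "Pi\<^sub>E J V \<subseteq> U"
    using U unfolding openin_product_topology_alt by fastforce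
  show thesis
  proof (rule that[of "{i \<in> J. V i \<noteq> UNIV}"])
    fix A assume A: "A \<subseteq> J" "A \<inter> {i \<in> J. V i \<noteq> UNIV} = {}"
    have "?h A \<in> Pi\<^sub>E J V"
    proof (rule PiE_I)
      fix i assume i: "i \<in> J"
      show "?h A i \<in> V i"
      proof (cases "V i = UNIV")
        case False
        then have "i \<notin> A" using A i by auto
        then show ?thesis using V(2) i by (auto simp: PiE_iff)
      qed simp
    qed auto
    then have "?h A \<in> U" using V(3) by blast
    then show "A \<in> W" using A W by simp
  qed (use V in auto)
qed

section \<open>The group of finite subsets of a regular cardinal\<close>

text \<open>By regularity a cofinal set has the cardinality of \<open>r\<close>, so \<open>K\<close>
  is not cofinal. In a well-order, a point that is not strictly below any member of \<open>K\<close>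
  is an upper bound of \<open>K\<close>.\<close>

lemma Card_order_bounded:
  assumes r: "Card_order r" "regularCard r" and K: "K \<subseteq> Field r" "|K| <o r"
  shows "\<exists>b\<in>Field r. \<forall>a\<in>K. (a, b) \<in> r"
proof -
  have "\<not> cofinal K r"
    using r(2) K not_ordLess_ordIso unfolding regularCard_def by blast
  then obtain b where b: "b \<in> Field r" "\<forall>a\<in>K. \<not> (b \<noteq> a \<and> (b, a) \<in> r)"
    unfolding cofinal_def by blast
  have "wo_rel r" using r(1) by (simp add: card_order_on_well_order_on wo_rel_def)
  then have "(a, b) \<in> r" if "a \<in> K" for a
    using b that K(1) by (intro wo_rel.in_notinI[of r b a]) auto
  with b(1) show ?thesis by blast
qed

lemma countable_card_of_ordLess:
  assumes "countable A" "natLeq <o r"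
  shows "|A| <o r"
proof -
  have "|A| \<le>o |UNIV :: nat set|"
    using assms(1) by (auto simp: countable_def intro: card_of_ordLeqI)
  also have "|UNIV :: nat set| =o natLeq" by (rule card_of_nat)
  finally show ?thesis using assms(2) ordLeq_ordLess_trans by blast
qed

text \<open>The sum of the two cardinalities exceeds that of the symmetric difference by twice that
  of the intersection.\<close>

lemma even_card_sym_diff:
  assumes "finite A" "finite B"
  shows "even (card (sym_diff A B)) \<longleftrightarrow> (even (card A) \<longleftrightarrow> even (card B))"
proof -
  have "card A = card (A - B) + card (A \<inter> B)" "card B = card (B - A) + card (A \<inter> B)"
    using assms card_Diff_subset_Int[of A B] card_Diff_subset_Int[of B A]
      card_mono[of A "A \<inter> B"] card_mono[of B "A \<inter> B"] by (auto simp: Int_commute)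
  moreover have "card (sym_diff A B) = card (A - B) + card (B - A)"
    using assms by (intro card_Un_disjoint) auto
  ultimately show ?thesis by (simp only: even_add) blast
qed

section \<open>The Boolean group and its bounded characters\<close>

locale bounded_characters =
  fixes r :: "'a rel"
  assumes Card_order: "Card_order r" and uncountable: "natLeq <o r"
    and regular: "regularCard r" and le_cardSuc: "r \<le>o cardSuc continuum"
begin

definition G :: "'a set monoid" where
  "G = symdiff_group (Fpow (Field r))"

definition kernel :: "'a set \<Rightarrow> 'a set set" where
  "kernel B = {X \<in> Fpow (Field r). even (card (X \<inter> B))}"

text \<open>Boundedness of \<open>B\<close> is what gives each kernel a tail: for an unbounded
  subset \<open>B\<close> of \<open>Field r\<close>, every tail contains a singleton on which the
  character is odd.\<close>

definition kernels :: "'a set set set" where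
  "kernels = {kernel B | B a. a \<in> Field r \<and> B \<subseteq> underS r a}"

text \<open>The kernel of a character stands for the character itself, so that a point of the
  completion, which is a set of kernels, has the type required by \<open>precompact_group\<close>.\<close>

definition embed :: "'a set \<Rightarrow> 'a set set set" where
  "embed X = {N \<in> kernels. X \<notin> N}"

definition T :: "'a set topology" where
  "T = pullback_topology (carrier G) embed (powerset_topology kernels)"

text \<open>The subgroup \<open>H\<^sub>a\<close> of the introduction.\<close>

definition tail :: "'a \<Rightarrow> 'a set set" where
  "tail a = {X \<in> Fpow (Field r). X \<inter> underS r a = {}}"

section \<open>Embedding into a compact group\<close>

lemma carrier_G: "carrier G = Fpow (Field r)"
  by (simp add: G_def)

lemma one_G: "\<one>\<^bsub>G\<^esub> = {}"
  by (simp add: G_def)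

lemma comm_group_G: "comm_group G"
  unfolding G_def by (rule comm_group_symdiff_group) (auto simp: Fpow_def)

lemma infinite_Field: "infinite (Field r)"
  using Card_order uncountable
  by (meson Card_order_iff_ordLeq_card_of card_of_Field_ordIso card_of_ordLeq_finite
      finite_iff_ordLess_natLeq natLeq_Card_order not_ordLess_ordLeq ordLess_imp_ordLeq
      ordIso_ordLess_trans ordLess_transitive)

lemma wo_rel: "wo_rel r"
  using Card_order by (simp add: card_order_on_well_order_on wo_rel_def)

lemma singleton_bounded:
  assumes "x \<in> Field r"
  shows "\<exists>a\<in>Field r. {x} \<subseteq> underS r a"
  using infinite_Card_order_limit[OF Card_order infinite_Field assms] by (auto simp: underS_def)

lemma kernel_sym_diff:
  assumes "X \<in> Fpow (Field r)" "Y \<in> Fpow (Field r)"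
  shows "sym_diff X Y \<in> kernel B \<longleftrightarrow> (X \<in> kernel B \<longleftrightarrow> Y \<in> kernel B)"
proof -
  have "sym_diff X Y \<inter> B = sym_diff (X \<inter> B) (Y \<inter> B)" by auto
  moreover have "sym_diff X Y \<in> Fpow (Field r)" using assms by (auto simp: Fpow_def)
  ultimately show ?thesis
    using assms even_card_sym_diff[of "X \<inter> B" "Y \<inter> B"] by (auto simp: kernel_def Fpow_def)
qed

lemma embed_hom: "embed \<in> hom G (symdiff_group (Pow kernels))"
proof (rule homI)
  fix X Y assume XY: "X \<in> carrier G" "Y \<in> carrier G"
  have "sym_diff X Y \<in> N \<longleftrightarrow> (X \<in> N \<longleftrightarrow> Y \<in> N)" if "N \<in> kernels" for N
    using kernel_sym_diff XY that by (auto simp: kernels_def carrier_G)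
  then have "embed (sym_diff X Y) = sym_diff (embed X) (embed Y)"
    unfolding embed_def by blast
  then show "embed (X \<otimes>\<^bsub>G\<^esub> Y) = embed X \<otimes>\<^bsub>symdiff_group (Pow kernels)\<^esub> embed Y"
    by (simp add: G_def)
qed (auto simp: embed_def)

lemma inj_embed: "inj_on embed (carrier G)"
proof (rule inj_onI)
  fix X Y assume XY: "X \<in> carrier G" "Y \<in> carrier G" "embed X = embed Y"
  \<comment> \<open>As \<open>embed\<close> is a homomorphism, injectivity amounts to a trivial
    kernel. A point \<open>x\<close> of \<open>?Z\<close> would be detected by the character of the
    singleton \<open>{x}\<close>.\<close>
  let ?Z = "sym_diff X Y"
  have Z: "?Z \<in> Fpow (Field r)" using XY by (auto simp: carrier_G Fpow_def)
  have "embed ?Z = sym_diff (embed X) (embed Y)"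
    using hom_mult[OF embed_hom XY(1,2)] by (simp add: G_def)
  then have "embed ?Z = {}" using XY(3) by simp
  have "?Z = {}"
  proof (rule ccontr)
    assume "?Z \<noteq> {}"
    then obtain x where x: "x \<in> ?Z" by blast
    with Z have "x \<in> Field r" by (auto simp: Fpow_def)
    then have "kernel {x} \<in> kernels"
      using singleton_bounded unfolding kernels_def by blast
    moreover have "?Z \<inter> {x} = {x}" using x by blast
    then have "?Z \<notin> kernel {x}" by (simp add: kernel_def)
    ultimately show False using \<open>embed ?Z = {}\<close> unfolding embed_def by blast
  qed
  then show "X = Y" by auto
qed

lemma precompact_G: "precompact_group G T"
  unfolding T_def
  by (rule precompact_group_pullback[OF comm_group.axioms(2)[OF comm_group_G] topological_group_Pow
      compact_space_powerset_topology embed_hom inj_embed])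

lemma topspace_T: "topspace T = carrier G"
  using precompact_G by (simp add: precompact_group_def topological_groupD(2))

text \<open>The kernel is the preimage under \<open>embed\<close> of the condition that a single
  coordinate is false.\<close>

lemma openin_kernel:
  assumes "a \<in> Field r" "B \<subseteq> underS r a"
  shows "openin T (kernel B)" "\<one>\<^bsub>G\<^esub> \<in> kernel B"
proof -
  have ker: "kernel B \<in> kernels" using assms unfolding kernels_def by blast
  have "continuous_map T (discrete_topology UNIV) ((\<lambda>A. kernel B \<in> A) \<circ> embed)"
    unfolding T_def
    by (intro continuous_map_pullback continuous_map_member_powerset_topology ker)
  then have "openin T {X \<in> topspace T. ((\<lambda>A. kernel B \<in> A) \<circ> embed) X \<in> {False}}"
    by (rule openin_continuous_map_preimage) simp
  moreover have "{X \<in> topspace T. ((\<lambda>A. kernel B \<in> A) \<circ> embed) X \<in> {False}} = kernel B"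
    using ker by (auto simp: embed_def topspace_T carrier_G kernel_def)
  ultimately show "openin T (kernel B)" by simp
  show "\<one>\<^bsub>G\<^esub> \<in> kernel B" by (simp add: kernel_def one_G Fpow_def)
qed

lemma identity_nhd_kernel:
  assumes "a \<in> Field r" "B \<subseteq> underS r a"
  shows "identity_nhd G T (kernel B)"
  using openin_kernel[OF assms] openin_subset[of T "kernel B"]
  by (auto simp: identity_nhd_def topspace_T)

section \<open>Tails and identity neighbourhoods\<close>

lemma tail_antimono: "(a, b) \<in> r \<Longrightarrow> tail b \<subseteq> tail a"
  using wo_rel.TRANS[OF wo_rel] wo_rel.ANTISYM[OF wo_rel] underS_incr[of r a b]
  by (auto simp: tail_def)

lemma tail_nontrivial: "a \<in> Field r \<Longrightarrow> {a} \<in> tail a"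
  by (auto simp: tail_def underS_def Fpow_def)

text \<open>A basic neighbourhood involves finitely many kernels. Each contains a tail, and the tail
  at a common upper bound of their indices lies in all of them.\<close>

lemma nhd_contains_tail:
  assumes "openin T U" "\<one>\<^bsub>G\<^esub> \<in> U"
  shows "\<exists>a\<in>Field r. tail a \<subseteq> U"
proof -
  obtain W where W: "openin (powerset_topology kernels) W" "U = embed -` W \<inter> carrier G"
    using assms(1) unfolding T_def openin_pullback_topology by blast
  have "embed {} = {}" by (auto simp: embed_def kernels_def kernel_def Fpow_def)
  then have "{} \<in> W" using W(2) assms(2) by (auto simp: one_G)
  then obtain F where F: "finite F" "F \<subseteq> kernels"
    "\<And>A. A \<subseteq> kernels \<Longrightarrow> A \<inter> F = {} \<Longrightarrow> A \<in> W"
    using powerset_topology_nhd_empty[OF W(1)] by metis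
  have "\<exists>a\<in>Field r. tail a \<subseteq> N" if N: "N \<in> kernels" for N
  proof -
    obtain B a where Ba: "a \<in> Field r" "B \<subseteq> underS r a" "N = kernel B"
      using N unfolding kernels_def by blast
    have "X \<in> kernel B" if "X \<in> tail a" for X
    proof -
      have "X \<inter> B = {}" using that Ba(2) unfolding tail_def by blast
      then show ?thesis using that by (simp add: kernel_def tail_def)
    qed
    then show ?thesis using Ba by blast
  qed
  then obtain f where f: "\<And>N. N \<in> kernels \<Longrightarrow> f N \<in> Field r \<and> tail (f N) \<subseteq> N"
    by metis
  have "|f ` F| <o r"
    by (intro countable_card_of_ordLess uncountable countable_finite finite_imageI F(1))
  then obtain a where a: "a \<in> Field r" "\<forall>b\<in>f ` F. (b, a) \<in> r"
    using Card_order_bounded[OF Card_order regular, of "f ` F"] F(2) f by blast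
  have "X \<in> U" if X: "X \<in> tail a" for X
  proof -
    have "X \<in> N" if "N \<in> F" for N
      using tail_antimono[of "f N" a] a that X f[of N] F(2) by blast
    then have "embed X \<inter> F = {}" by (auto simp: embed_def)
    then have "embed X \<in> W" by (intro F(3)) (auto simp: embed_def)
    then show ?thesis using W(2) X by (simp add: tail_def carrier_G)
  qed
  then show ?thesis using a(1) by blast
qed

text \<open>Each neighbourhood contains a tail. Regularity bounds the fewer than \<open>r\<close>
  chosen indices, and tails shrink as the index grows.\<close>

lemma Inter_nhds_contains_tail:
  assumes "|I| <o r" "\<And>i. i \<in> I \<Longrightarrow> \<exists>W. openin T W \<and> \<one>\<^bsub>G\<^esub> \<in> W \<and> W \<subseteq> U i"
  shows "\<exists>a\<in>Field r. tail a \<subseteq> (\<Inter>i\<in>I. U i)"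
proof -
  have "\<exists>a\<in>Field r. tail a \<subseteq> U i" if "i \<in> I" for i
    using nhd_contains_tail assms(2)[OF that] by (meson subset_trans)
  then obtain f where f: "\<And>i. i \<in> I \<Longrightarrow> f i \<in> Field r \<and> tail (f i) \<subseteq> U i"
    by metis
  have "|f ` I| <o r"
    using assms(1) card_of_image ordLeq_ordLess_trans by blast
  then obtain a where "a \<in> Field r" "\<forall>b\<in>f ` I. (b, a) \<in> r"
    using Card_order_bounded[OF Card_order regular, of "f ` I"] f by blast
  then show ?thesis using tail_antimono f by blast
qed

lemma Inter_nhds_nontrivial:
  assumes "|I| <o r" "\<And>i. i \<in> I \<Longrightarrow> \<exists>W. openin T W \<and> \<one>\<^bsub>G\<^esub> \<in> W \<and> W \<subseteq> U i"
  shows "\<exists>x\<in>carrier G. x \<noteq> \<one>\<^bsub>G\<^esub> \<and> x \<in> (\<Inter>i\<in>I. U i)"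
proof -
  obtain a where a: "a \<in> Field r" "tail a \<subseteq> (\<Inter>i\<in>I. U i)"
    using Inter_nhds_contains_tail[of I U] assms by blast
  then have "{a} \<in> (\<Inter>i\<in>I. U i)" "{a} \<in> carrier G"
    using tail_nontrivial by (auto simp: carrier_G Fpow_def)
  then show ?thesis by (auto simp: one_G)
qed

lemma tail_contains_countable_Inter:
  assumes a: "a \<in> Field r"
  shows "\<exists>V :: nat \<Rightarrow> 'a set set. (\<forall>n. identity_nhd G T (V n)) \<and> (\<Inter>n. V n) \<subseteq> tail a"
proof -
  \<comment> \<open>A proper initial segment is strictly smaller than \<open>r\<close>, and a
    cardinal strictly below the successor of the continuum is at most the continuum.\<close>
  have "|underS r a| <o cardSuc continuum"
    using card_of_underS[OF Card_order a] le_cardSuc ordLess_ordLeq_trans by blast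
  then have "|underS r a| \<le>o continuum"
    by (subst (asm) cardSuc_ordLeq_ordLess) (auto intro: Card_order_cexp card_of_Card_order)
  also have "continuum \<le>o |UNIV :: (nat \<Rightarrow> bool) set|"
    unfolding cexp_def by (rule card_of_mono1) simp
  finally have "|underS r a| \<le>o |UNIV :: (nat \<Rightarrow> bool) set|" .
  then obtain f :: "'a \<Rightarrow> nat \<Rightarrow> bool" where f: "inj_on f (underS r a)"
    by (auto simp flip: card_of_ordLeq)
  \<comment> \<open>Through \<open>f\<close>, points below \<open>a\<close> are coded by binary
    sequences, and \<open>B l\<close> collects those whose code extends the finite word
    \<open>l\<close>. There are countably many words, all of them reached by
    \<open>from_nat\<close>.\<close>
  define B where "B l = {b \<in> underS r a. map (f b) [0..<length l] = l}" for l
  define V where "V n = kernel (B (from_nat n))" for n :: nat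
  have B_sub: "B l \<subseteq> underS r a" for l by (auto simp: B_def)
  have "X \<in> tail a" if X: "\<And>n. X \<in> V n" for X
  proof (rule ccontr)
    assume "X \<notin> tail a"
    moreover have XG: "X \<in> Fpow (Field r)" using X[of 0] by (simp add: V_def kernel_def)
    ultimately obtain x where x: "x \<in> X" "x \<in> underS r a" by (auto simp: tail_def)
    \<comment> \<open>A prefix of \<open>f x\<close> separates \<open>x\<close> from the finitely many other points of \<open>X\<close> below \<open>a\<close>,
      so the character of that prefix is odd on \<open>X\<close>.\<close>
    let ?Y = "X \<inter> underS r a - {x}"
    have "\<forall>y\<in>?Y. \<exists>k. f y k \<noteq> f x k"
      using f x by (auto simp: inj_on_def fun_eq_iff)
    then obtain k where k: "\<And>y. y \<in> ?Y \<Longrightarrow> f y (k y) \<noteq> f x (k y)" by metis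
    have "finite (k ` ?Y)" using XG by (auto simp: Fpow_def)
    then obtain m where m: "\<And>y. y \<in> ?Y \<Longrightarrow> k y < m"
      by (metis finite_nat_set_iff_bounded image_eqI)
    let ?l = "map (f x) [0..<m]"
    have "y \<notin> B ?l" if "y \<in> ?Y" for y
      using k[OF that] m[OF that] by (auto simp: B_def)
    then have "X \<inter> B ?l = {x}"
      using x by (auto simp: B_def)
    then have "X \<notin> kernel (B ?l)" by (simp add: kernel_def)
    then show False using X[of "to_nat ?l"] by (simp add: V_def)
  qed
  moreover have "identity_nhd G T (V n)" for n
    unfolding V_def by (rule identity_nhd_kernel[OF a B_sub])
  ultimately show ?thesis by (intro exI[of _ V]) blast
qed

section \<open>Pseudocharacter and pseudo-fineness index\<close>

lemma pseudo_fine_below: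
  assumes "Card_order \<kappa>" "\<kappa> <o r"
  shows "pseudo_fine G T \<kappa>"
  unfolding pseudo_fine_def
proof (intro allI impI)
  fix U assume U: "\<forall>i\<in>Field \<kappa>. identity_nhd G T (U i)"
  have "|Field \<kappa>| <o r"
    using assms card_of_Field_ordIso ordIso_ordLess_trans by blast
  then obtain a where a: "a \<in> Field r" "tail a \<subseteq> (\<Inter>i\<in>Field \<kappa>. U i)"
    using Inter_nhds_contains_tail[of "Field \<kappa>" U] U by (auto simp: identity_nhd_def)
  \<comment> \<open>The tail at \<open>a\<close> lies between a countable intersection of
    neighbourhoods and the given one.\<close>
  show "\<exists>V :: nat \<Rightarrow> 'a set set. (\<forall>n. identity_nhd G T (V n)) \<and> (\<Inter>n. V n) \<subseteq> (\<Inter>i\<in>Field \<kappa>. U i)"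
    using tail_contains_countable_Inter[OF a(1)] a(2) by (meson subset_trans)
qed

text \<open>A copy of \<open>r\<close> on the type over which \<open>pseudocharacter\<close> and \<open>pfi\<close> are minimised.\<close>

definition cardinal_copy :: "'a set set rel" where
  "cardinal_copy = |(\<lambda>x. {{x}}) ` Field r|"

text \<open>The index \<open>{{x}}\<close> of the copy is decoded to \<open>x\<close>, giving the
  kernel of the character that tests whether \<open>x\<close> is a member.\<close>

definition separating_nhd :: "'a set set \<Rightarrow> 'a set set" where
  "separating_nhd N = kernel {THE x. N = {{x}}}"

lemma cardinal_copy:
  "Card_order cardinal_copy" "cardinal_copy =o r"
  "Field cardinal_copy = (\<lambda>x. {{x}}) ` Field r" "infinite (Field cardinal_copy)"
proof -
  have inj: "inj_on (\<lambda>x. {{x}}) (Field r)" by (auto simp: inj_on_def)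
  then have "|(\<lambda>x. {{x}}) ` Field r| =o |Field r|"
    by (meson bij_betw_imageI card_of_ordIso ordIso_symmetric)
  then show "cardinal_copy =o r"
    unfolding cardinal_copy_def using card_of_Field_ordIso[OF Card_order] ordIso_transitive by blast
  show "infinite (Field cardinal_copy)"
    using infinite_Field inj by (simp add: cardinal_copy_def Field_card_of finite_image_iff)
qed (simp_all add: cardinal_copy_def Field_card_of card_of_card_order_on)

lemma separating_nhds:
  "N \<in> Field cardinal_copy \<Longrightarrow> openin T (separating_nhd N) \<and> \<one>\<^bsub>G\<^esub> \<in> separating_nhd N"
  "carrier G \<inter> (\<Inter>N\<in>Field cardinal_copy. separating_nhd N) = {\<one>\<^bsub>G\<^esub>}"
proof -
  show nhd: "openin T (separating_nhd N) \<and> \<one>\<^bsub>G\<^esub> \<in> separating_nhd N"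
    if N: "N \<in> Field cardinal_copy" for N
  proof -
    obtain x where x: "x \<in> Field r" "N = {{x}}" using N cardinal_copy(3) by blast
    then have "separating_nhd N = kernel {x}" by (simp add: separating_nhd_def)
    then show ?thesis using openin_kernel singleton_bounded[OF x(1)] by metis
  qed
  have "X = {}" if X: "X \<in> carrier G" "\<And>N. N \<in> Field cardinal_copy \<Longrightarrow> X \<in> separating_nhd N" for X
  proof (rule ccontr)
    assume "X \<noteq> {}"
    then obtain x where x: "x \<in> X" by blast
    then have "x \<in> Field r" using X(1) by (auto simp: carrier_G Fpow_def)
    then have "X \<in> separating_nhd {{x}}" using X(2) cardinal_copy(3) by blast
    then show False using x by (simp add: separating_nhd_def kernel_def)
  qed
  then show "carrier G \<inter> (\<Inter>N\<in>Field cardinal_copy. separating_nhd N) = {\<one>\<^bsub>G\<^esub>}"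
    using nhd comm_group.axioms(2)[OF comm_group_G, THEN group.is_monoid, THEN monoid.one_closed]
    by (auto simp: one_G)
qed

text \<open>The separating neighbourhoods meet in the identity alone, while countably many
  neighbourhoods always share a further point because \<open>r\<close> is uncountable.\<close>

lemma not_pseudo_fine: "\<not> pseudo_fine G T cardinal_copy"
proof
  assume "pseudo_fine G T cardinal_copy"
  moreover have "identity_nhd G T (separating_nhd N)" if "N \<in> Field cardinal_copy" for N
    using separating_nhds(1)[OF that] openin_subset[of T "separating_nhd N"]
    by (auto simp: identity_nhd_def topspace_T)
  ultimately obtain V :: "nat \<Rightarrow> 'a set set" where V: "\<And>n. identity_nhd G T (V n)"
    "(\<Inter>n. V n) \<subseteq> (\<Inter>N\<in>Field cardinal_copy. separating_nhd N)"
    unfolding pseudo_fine_def by meson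
  have "|UNIV :: nat set| <o r"
    by (intro countable_card_of_ordLess uncountable) simp
  then obtain x where x: "x \<in> carrier G" "x \<noteq> \<one>\<^bsub>G\<^esub>" "x \<in> (\<Inter>n. V n)"
    using Inter_nhds_nontrivial[of "UNIV :: nat set" V] V(1) by (auto simp: identity_nhd_def)
  then have "x \<in> carrier G \<inter> (\<Inter>N\<in>Field cardinal_copy. separating_nhd N)"
    using subsetD[OF V(2)] by (intro IntI)
  then have "x = \<one>\<^bsub>G\<^esub>" unfolding separating_nhds(2) by simp
  with x(2) show False ..
qed

lemma uncountable_pseudocharacter: "natLeq <o pseudocharacter G T"
proof (rule ccontr)
  \<comment> \<open>The least cardinal has its defining property only once some cardinal is known to
    satisfy it; \<open>cardinal_copy\<close> with the separating neighbourhoods is that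
    witness.\<close>
  note least = least_cardinal[where P = "\<lambda>\<kappa>. \<exists>U :: 'a set set \<Rightarrow> 'a set set.
     (\<forall>a\<in>Field \<kappa>. openin T (U a) \<and> \<one>\<^bsub>G\<^esub> \<in> U a) \<and>
     carrier G \<inter> (\<Inter>a\<in>Field \<kappa>. U a) = {\<one>\<^bsub>G\<^esub>}",
     OF cardinal_copy(1), folded pseudocharacter_def]
  have P: "\<exists>U. (\<forall>a\<in>Field cardinal_copy. openin T (U a) \<and> \<one>\<^bsub>G\<^esub> \<in> U a) \<and>
     carrier G \<inter> (\<Inter>a\<in>Field cardinal_copy. U a) = {\<one>\<^bsub>G\<^esub>}"
    using separating_nhds by blast
  let ?\<kappa> = "pseudocharacter G T"
  assume "\<not> natLeq <o ?\<kappa>"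
  then have "?\<kappa> <o r"
    using least(1)[OF P] uncountable
    by (meson card_order_on_well_order_on natLeq_Well_order not_ordLess_iff_ordLeq ordLeq_ordLess_trans)
  then have "|Field ?\<kappa>| <o r"
    using card_of_Field_ordIso[OF least(1)[OF P]] ordIso_ordLess_trans by blast
  moreover obtain U where U: "\<forall>a\<in>Field ?\<kappa>. openin T (U a) \<and> \<one>\<^bsub>G\<^esub> \<in> U a"
    "carrier G \<inter> (\<Inter>a\<in>Field ?\<kappa>. U a) = {\<one>\<^bsub>G\<^esub>}"
    using least(2)[OF P] by blast
  ultimately show False
    using Inter_nhds_nontrivial[of "Field ?\<kappa>" U] by blast
qed

text \<open>The copy of \<open>r\<close> bounds the index from above. A smaller value would
  contradict pseudo-fineness below \<open>r\<close>, since the minimum itself is attained.\<close>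

lemma pfi_eq: "pfi G T =o r"
proof -
  note least = least_cardinal[where P = "\<lambda>\<kappa> :: 'a set set rel. infinite (Field \<kappa>) \<and> \<not> pseudo_fine G T \<kappa>",
      OF cardinal_copy(1), OF conjI, OF cardinal_copy(4) not_pseudo_fine, folded pfi_def]
  have "pfi G T \<le>o r"
    using least(3)[OF cardinal_copy(1)] cardinal_copy(2,4) not_pseudo_fine ordLeq_ordIso_trans by blast
  moreover have "\<not> pfi G T <o r"
    using pseudo_fine_below[OF least(1)] least(2) by blast
  ultimately show ?thesis
    using ordLeq_iff_ordLess_or_ordIso by blast
qed

end

theorem theorem2p3:
  fixes \<tau> :: "'a rel"
  assumes "Card_order \<tau>"
    and "natLeq <o \<tau>"
    and "regularCard \<tau>"
    and "\<tau> \<le>o cardSuc continuum"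
  shows "\<exists>(G :: 'a set monoid) (T :: 'a set topology).
           comm_group G \<and> precompact_group G T \<and>
           natLeq <o pseudocharacter G T \<and> pfi G T =o \<tau>"
proof -
  interpret bounded_characters \<tau>
    using assms by (rule bounded_characters.intro)
  show ?thesis
    using comm_group_G precompact_G uncountable_pseudocharacter pfi_eq by blast
qed

end
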